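(* Let $Y\in\mathcal Y^d$ and let $A,B$ be two (stochastic) forecasts for $R$ taking values in $\widehat{\mathcal P}(\mathbb R^d;\mathbb R^d_+)$. Assume that $R(Z)\in\widehat{\mathcal P}(\mathbb R^d;\mathbb R^d_+)$ for all $Z\in\mathcal Y^d$. Then $A$ dominates $B$ if and only if $$\mathbf E[S_{R,k}(A,Y)]\le\mathbf E[S_{R,k}(B,Y)]\qquad\text{for all }k\in\mathbb R^d,$$ where $S_{R,k}(A,y)=\big(\mathbf 1_{R(y)\setminus A}(k)-\mathbf 1_{A\setminus R(y)}(k)\big)V_{R_0}(k,y)$ are the elementary scores.
   Context: Setting: $(\Omega,\mathfrak F,\mathbb P)$ is an atomless probability space, $d\ge1$, $\mathcal Y^d\subseteq L^0(\Omega;\mathbb R^d)$ is a class of random vectors closed under translation by constants $k\in\mathbb R^d$. $\Lambda\colon\mathbb R^d\to\mathbb R$ is an aggregation function, i.e. non-decreasing for the componentwise order. $\mathcal Y\subseteq L^0(\Omega;\mathbb R)$ contains $\Lambda(Y)$ for all $Y\in\mathcal Y^d$ and is closed under translation by constants. $\mathcal M^d$ is the class of distributions of elements of $\mathcal Y^d$. $\rho\colon\mathcal Y\to\mathbb R$ is a law-invariant scalar risk measure that is cash-invariant ($\rho(X+m)=\rho(X)-m$) and monotone ($X\ge Z$ a.s. implies $\rho(X)\le\rho(Z)$). Define the law-invariant map $R(Y)=\{k\in\mathbb R^d:\rho(\Lambda(Y+k))\le0\}$, write $R(F_Y)=R(Y)$, and for $y\in\mathbb R^d$ put $R(y):=R(\delta_y)=\{k:\rho(\Lambda(y+k))\le0\}$,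 where $\rho$ is understood to be defined (with the same properties) on constants as well. $\widehat{\mathcal P}(\mathbb R^d;\mathbb R^d_+)$ is the class of Borel sets $B\subseteq\mathbb R^d$ with $B=B+\mathbb R^d_+$ and $B\ne\mathbb R^d$. $V_{R_0}\colon\mathbb R^d\times\mathbb R^d\to\mathbb R$ is a fixed function such that for all $F\in\mathcal M^d\cup\{\delta_y:y\in\mathbb R^d\}$ and $k\in\mathbb R^d$, $\int V_{R_0}(k,y)\,dF(y)$ lies in $(-\infty,0]$ if $k\notin R(F)$ and in $[0,\infty)$ if $k\in R(F)$; consequently the elementary scores $S_{R,k}$ are non-negative. For a $\sigma$-finite non-negative measure $\pi$ on $\mathcal B(\mathbb R^d)$ put $S_{R,\pi}(A,y)=\int_{\mathbb R^d}S_{R,k}(A,y)\,\pi(dk)\in[0,\infty]$. Dominance: $A$ dominates $B$ if $\mathbf E[S_{R,\pi}(A,Y)]\le\mathbf E[S_{R,\pi}(B,Y)]$ for all $\sigma$-finite non-negative measures $\pi$ on $\mathcal B(\mathbb R^d)$. Expectations are over the joint distribution of forecasts and observation; the random sets $A,B$ and $V_{R_0}$ are tacitly assumed measurable enough (jointly in $k$ and $\omega$) that all these integrals are well defined. *)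

theory Defs
  imports "HOL-Probability.Probability"
begin

text \<open>
  Elements of \<open>L\<^sup>0\<close> are represented by measurable functions rather than by almost-sure equivalence
  classes; a law-invariant risk measure does not distinguish almost surely equal representatives.
  The space of \<open>d\<close>-dimensional vectors is \<^typ>\<open>real ^ 'n\<close> with \<open>d = CARD('n)\<close>, whose library
  order is the componentwise one.
\<close>

definition atomless :: "'w measure \<Rightarrow> bool" where
  "atomless M \<longleftrightarrow>
    (\<forall>E\<in>sets M. emeasure M E > 0 \<longrightarrow>
      (\<exists>F\<in>sets M. F \<subseteq> E \<and> 0 < emeasure M F \<and> emeasure M F < emeasure M E))"

definition translation_closed :: "('w \<Rightarrow> 'b::plus) set \<Rightarrow> bool" where
  "translation_closed \<Y> \<longleftrightarrow> (\<forall>Y\<in>\<Y>. \<forall>k. (\<lambda>\<omega>. Y \<omega> + k) \<in> \<Y>)"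

definition law_invariant_on ::
    "'w measure \<Rightarrow> ('w \<Rightarrow> real) set \<Rightarrow> (('w \<Rightarrow> real) \<Rightarrow> real) \<Rightarrow> bool" where
  "law_invariant_on M \<X> \<rho> \<longleftrightarrow>
    (\<forall>X\<in>\<X>. \<forall>Z\<in>\<X>. distr M borel X = distr M borel Z \<longrightarrow> \<rho> X = \<rho> Z)"

definition cash_invariant_on :: "('w \<Rightarrow> real) set \<Rightarrow> (('w \<Rightarrow> real) \<Rightarrow> real) \<Rightarrow> bool" where
  "cash_invariant_on \<X> \<rho> \<longleftrightarrow> (\<forall>X\<in>\<X>. \<forall>m. \<rho> (\<lambda>\<omega>. X \<omega> + m) = \<rho> X - m)"

definition monotone_risk_on ::
    "'w measure \<Rightarrow> ('w \<Rightarrow> real) set \<Rightarrow> (('w \<Rightarrow> real) \<Rightarrow> real) \<Rightarrow> bool" where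
  "monotone_risk_on M \<X> \<rho> \<longleftrightarrow>
    (\<forall>X\<in>\<X>. \<forall>Z\<in>\<X>. (AE \<omega> in M. X \<omega> \<ge> Z \<omega>) \<longrightarrow> \<rho> X \<le> \<rho> Z)"

definition constants :: "('w \<Rightarrow> 'b) set" where
  "constants = range (\<lambda>c \<omega>. c)"

definition systemic_risk ::
    "(('w \<Rightarrow> real) \<Rightarrow> real) \<Rightarrow> (real ^ 'n \<Rightarrow> real) \<Rightarrow> ('w \<Rightarrow> real ^ 'n) \<Rightarrow> (real ^ 'n) set" where
  "systemic_risk \<rho> \<Lambda> Y = {k. \<rho> (\<lambda>\<omega>. \<Lambda> (Y \<omega> + k)) \<le> 0}"

abbreviation systemic_risk_at ::
    "(('w \<Rightarrow> real) \<Rightarrow> real) \<Rightarrow> (real ^ 'n \<Rightarrow> real) \<Rightarrow> real ^ 'n \<Rightarrow> (real ^ 'n) set" where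
  "systemic_risk_at \<rho> \<Lambda> y \<equiv> systemic_risk \<rho> \<Lambda> (\<lambda>\<omega>. y)"

definition borel_upper_sets :: "(real ^ 'n) set set" where
  "borel_upper_sets = {B \<in> sets borel. B = {b + z |b z. b \<in> B \<and> 0 \<le> z} \<and> B \<noteq> UNIV}"

text \<open>
  The value \<open>K\<close> of the risk functional at the distribution \<open>F\<close> is separated from its complement by
  the sign of \<open>k \<mapsto> \<integral> V(k, y) dF(y)\<close>. Integrability is required explicitly since a
  Bochner integral that does not exist is \<open>0\<close>.
\<close>

definition oriented_at ::
    "(real ^ 'n \<Rightarrow> real ^ 'n \<Rightarrow> real) \<Rightarrow> (real ^ 'n) measure \<Rightarrow> (real ^ 'n) set \<Rightarrow> bool" where
  "oriented_at V F K \<longleftrightarrow>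
    (\<forall>k. integrable F (V k) \<and>
      (k \<notin> K \<longrightarrow> (\<integral>y. V k y \<partial>F) \<le> 0) \<and>
      (k \<in> K \<longrightarrow> (\<integral>y. V k y \<partial>F) \<ge> 0))"

definition elementary_score ::
    "(('w \<Rightarrow> real) \<Rightarrow> real) \<Rightarrow> (real ^ 'n \<Rightarrow> real) \<Rightarrow> (real ^ 'n \<Rightarrow> real ^ 'n \<Rightarrow> real) \<Rightarrow>
      real ^ 'n \<Rightarrow> (real ^ 'n) set \<Rightarrow> real ^ 'n \<Rightarrow> real" where
  "elementary_score \<rho> \<Lambda> V k A y =
    (indicator (systemic_risk_at \<rho> \<Lambda> y - A) k - indicator (A - systemic_risk_at \<rho> \<Lambda> y) k) * V k y"

text \<open>
  By the following lemma, elementary scores may be integrated as \<^typ>\<open>ennreal\<close>-valued functions: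
  the truncation of negative numbers by \<^const>\<open>ennreal\<close> never takes effect.
\<close>

lemma elementary_score_nonneg:
  assumes "oriented_at V (return borel y) (systemic_risk_at \<rho> \<Lambda> y)"
  shows "elementary_score \<rho> \<Lambda> V k A y \<ge> 0"
proof -
  have "V k \<in> borel_measurable borel"
    using assms by (auto simp: oriented_at_def dest!: borel_measurable_integrable)
  then have "(\<integral>z. V k z \<partial>return borel y) = V k y"
    by (intro integral_return) auto
  then show ?thesis
    using assms by (auto simp: oriented_at_def elementary_score_def indicator_def dest: spec[of _ k])
qed

definition mixture_score ::
    "(('w \<Rightarrow> real) \<Rightarrow> real) \<Rightarrow> (real ^ 'n \<Rightarrow> real) \<Rightarrow> (real ^ 'n \<Rightarrow> real ^ 'n \<Rightarrow> real) \<Rightarrow>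
      (real ^ 'n) measure \<Rightarrow> (real ^ 'n) set \<Rightarrow> real ^ 'n \<Rightarrow> ennreal" where
  "mixture_score \<rho> \<Lambda> V \<pi> A y = (\<integral>\<^sup>+k. ennreal (elementary_score \<rho> \<Lambda> V k A y) \<partial>\<pi>)"

definition dominates ::
    "'w measure \<Rightarrow> (('w \<Rightarrow> real) \<Rightarrow> real) \<Rightarrow> (real ^ 'n \<Rightarrow> real) \<Rightarrow> (real ^ 'n \<Rightarrow> real ^ 'n \<Rightarrow> real) \<Rightarrow>
      ('w \<Rightarrow> real ^ 'n) \<Rightarrow> ('w \<Rightarrow> (real ^ 'n) set) \<Rightarrow> ('w \<Rightarrow> (real ^ 'n) set) \<Rightarrow> bool" where
  "dominates M \<rho> \<Lambda> V Y A B \<longleftrightarrow>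
    (\<forall>\<pi>. sigma_finite_measure \<pi> \<and> sets \<pi> = sets borel \<longrightarrow>
      (\<integral>\<^sup>+\<omega>. mixture_score \<rho> \<Lambda> V \<pi> (A \<omega>) (Y \<omega>) \<partial>M)
        \<le> (\<integral>\<^sup>+\<omega>. mixture_score \<rho> \<Lambda> V \<pi> (B \<omega>) (Y \<omega>) \<partial>M))"

text \<open>
  Joint measurability, in \<open>k\<close> and the scenario, of the elementary scores of a random set against the
  observation; this is what makes all the expected scores above well defined.
\<close>

definition score_measurable ::
    "'w measure \<Rightarrow> (('w \<Rightarrow> real) \<Rightarrow> real) \<Rightarrow> (real ^ 'n \<Rightarrow> real) \<Rightarrow> (real ^ 'n \<Rightarrow> real ^ 'n \<Rightarrow> real) \<Rightarrow>
      ('w \<Rightarrow> real ^ 'n) \<Rightarrow> ('w \<Rightarrow> (real ^ 'n) set) \<Rightarrow> bool" where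
  "score_measurable M \<rho> \<Lambda> V Y A \<longleftrightarrow>
    (\<lambda>(k, \<omega>). elementary_score \<rho> \<Lambda> V k (A \<omega>) (Y \<omega>)) \<in> borel_measurable (borel \<Otimes>\<^sub>M M)"

end

theory Submission
  imports Defs
begin

text \<open>
  By Tonelli the expected score of a mixture is the mixture of the expected elementary scores, and
  the elementary score at \<open>k\<close> is the mixture with respect to the Dirac measure at \<open>k\<close>.
\<close>

lemma nn_integral_mixture_score:
  assumes "sigma_finite_measure M" "sigma_finite_measure \<pi>" "sets \<pi> = sets borel"
    and "score_measurable M \<rho> \<Lambda> V Y A"
  shows "(\<integral>\<^sup>+\<omega>. mixture_score \<rho> \<Lambda> V \<pi> (A \<omega>) (Y \<omega>) \<partial>M) =
    (\<integral>\<^sup>+k. (\<integral>\<^sup>+\<omega>. ennreal (elementary_score \<rho> \<Lambda> V k (A \<omega>) (Y \<omega>)) \<partial>M) \<partial>\<pi>)"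
proof -
  \<comment> \<open>The factor \<open>\<pi>\<close> comes first to match the order
    \<open>(k, \<omega>)\<close> in \<open>score_measurable\<close>; \<open>Fubini\<close> then
    reads exactly as the claimed exchange, integration over \<open>k\<close> being the inner one on
    the left.\<close>
  interpret pair_sigma_finite \<pi> M
    using assms(1,2) by (simp add: pair_sigma_finite_def)
  \<comment> \<open>Joint measurability is assumed over \<open>borel\<close>. It carries over to
    \<open>\<pi>\<close> because measurability depends only on the sigma-algebra.\<close>
  have "sets (\<pi> \<Otimes>\<^sub>M M) = sets (borel \<Otimes>\<^sub>M M)"
    by (intro sets_pair_measure_cong assms refl)
  then have "(\<lambda>(k, \<omega>). ennreal (elementary_score \<rho> \<Lambda> V k (A \<omega>) (Y \<omega>)))
      \<in> borel_measurable (\<pi> \<Otimes>\<^sub>M M)"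
    using measurable_compose[OF assms(4)[unfolded score_measurable_def] measurable_ennreal]
    by (simp add: case_prod_unfold cong: measurable_cong_sets)
  from Fubini[OF this] show ?thesis
    by (simp add: mixture_score_def)
qed

text \<open>Integrating against a Dirac measure evaluates the integrand at its atom, once the
  integrand is Borel in \<open>k\<close>. That holds for a fixed scenario in \<open>space M\<close>,
  as a section of a jointly measurable function.\<close>

lemma mixture_score_return:
  assumes "score_measurable M \<rho> \<Lambda> V Y A" "\<omega> \<in> space M"
  shows "mixture_score \<rho> \<Lambda> V (return borel k) (A \<omega>) (Y \<omega>) =
    ennreal (elementary_score \<rho> \<Lambda> V k (A \<omega>) (Y \<omega>))"
proof -
  have "(\<lambda>k. elementary_score \<rho> \<Lambda> V k (A \<omega>) (Y \<omega>)) \<in> borel_measurable borel"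
    using measurable_Pair2'[OF assms(2), of borel] assms(1)
    by (auto simp: score_measurable_def dest: measurable_compose)
  then show ?thesis
    by (simp add: mixture_score_def nn_integral_return)
qed

theorem corollary3p12:
  fixes M :: "'w measure"
    and \<Y>d :: "('w \<Rightarrow> real ^ 'n) set"
    and \<Y> :: "('w \<Rightarrow> real) set"
    and \<Lambda> :: "real ^ 'n \<Rightarrow> real"
    and \<rho> :: "('w \<Rightarrow> real) \<Rightarrow> real"
    and V :: "real ^ 'n \<Rightarrow> real ^ 'n \<Rightarrow> real"
    and Y :: "'w \<Rightarrow> real ^ 'n"
    and A B :: "'w \<Rightarrow> (real ^ 'n) set"
  assumes "prob_space M" and "atomless M"
    and "\<Y>d \<subseteq> borel_measurable M" and "translation_closed \<Y>d"
    and "mono \<Lambda>"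
    and "\<Y> \<subseteq> borel_measurable M" and "translation_closed \<Y>"
    and "\<And>Z. Z \<in> \<Y>d \<Longrightarrow> (\<lambda>\<omega>. \<Lambda> (Z \<omega>)) \<in> \<Y>"
    and "law_invariant_on M (\<Y> \<union> constants) \<rho>"
    and "cash_invariant_on (\<Y> \<union> constants) \<rho>"
    and "monotone_risk_on M (\<Y> \<union> constants) \<rho>"
    and "\<And>Z. Z \<in> \<Y>d \<Longrightarrow> oriented_at V (distr M borel Z) (systemic_risk \<rho> \<Lambda> Z)"
    and "\<And>y. oriented_at V (return borel y) (systemic_risk_at \<rho> \<Lambda> y)"
    and "Y \<in> \<Y>d"
    and "\<And>\<omega>. \<omega> \<in> space M \<Longrightarrow> A \<omega> \<in> borel_upper_sets"
    and "\<And>\<omega>. \<omega> \<in> space M \<Longrightarrow> B \<omega> \<in> borel_upper_sets"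
    and "score_measurable M \<rho> \<Lambda> V Y A" and "score_measurable M \<rho> \<Lambda> V Y B"
    and "\<And>Z. Z \<in> \<Y>d \<Longrightarrow> systemic_risk \<rho> \<Lambda> Z \<in> borel_upper_sets"
  shows "dominates M \<rho> \<Lambda> V Y A B \<longleftrightarrow>
    (\<forall>k. (\<integral>\<^sup>+\<omega>. ennreal (elementary_score \<rho> \<Lambda> V k (A \<omega>) (Y \<omega>)) \<partial>M)
      \<le> (\<integral>\<^sup>+\<omega>. ennreal (elementary_score \<rho> \<Lambda> V k (B \<omega>) (Y \<omega>)) \<partial>M))"
proof -
  interpret prob_space M by fact
  show ?thesis (is "_ \<longleftrightarrow> (\<forall>k. ?S A k \<le> ?S B k)")
  proof
    assume dom: "dominates M \<rho> \<Lambda> V Y A B"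
    show "\<forall>k. ?S A k \<le> ?S B k"
    proof
      fix k :: "real ^ 'n"
      \<comment> \<open>The Dirac measure at \<open>k\<close> is thus among the measures over which
        \<open>dominates\<close> quantifies.\<close>
      have "sigma_finite_measure (return borel k)"
        by (intro prob_space_imp_sigma_finite prob_space_return) simp
      then have "(\<integral>\<^sup>+\<omega>. mixture_score \<rho> \<Lambda> V (return borel k) (A \<omega>) (Y \<omega>) \<partial>M)
          \<le> (\<integral>\<^sup>+\<omega>. mixture_score \<rho> \<Lambda> V (return borel k) (B \<omega>) (Y \<omega>) \<partial>M)"
        using dom by (simp add: dominates_def)
      \<comment> \<open>The congruence rule supplies \<open>\<omega> \<in> space M\<close> under the
        integral, the condition for collapsing the Dirac mixture.\<close>
      then show "?S A k \<le> ?S B k"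
        using assms(17,18) by (simp add: mixture_score_return cong: nn_integral_cong)
    qed
  next
    assume "\<forall>k. ?S A k \<le> ?S B k"
    \<comment> \<open>After the exchange both sides are integrals over \<open>k\<close> against the
      same \<open>\<pi>\<close>, so the inequality for each \<open>k\<close> integrates. The values
      lie in \<open>ennreal\<close>, so infinite expected scores are covered.\<close>
    then show "dominates M \<rho> \<Lambda> V Y A B"
      using assms(17,18)
      by (simp add: dominates_def nn_integral_mixture_score[OF sigma_finite_measure_axioms]
          nn_integral_mono)
  qed
qed

end
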